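(* Let $G$ be a graph with $n\ge 1$ vertices, $m$ edges and degeneracy $d$. Then $\operatorname{mag}(G)\le n+dm$, and thus $\operatorname{vol}(G)<2n+2dm$.
   Context: Graphs are finite, simple and undirected. The degeneracy of a graph $G$ is the maximum, over all (nonempty) induced subgraphs $H$ of $G$, of the minimum degree of $H$. An injection $f:V(G)\to\mathbb{Z}^+$ is antimagic if $f(v)+f(w)\neq f(x)+f(y)$ for all distinct edges $vw,xy\in E(G)$. With $[k]=\{1,\dots,k\}$, $\operatorname{mag}(G)$ is the minimum $k$ such that $G$ has an antimagic injection $V(G)\to[k]$. Given an injection $\lambda:V(G)\to\{0,1\}^d$, for each edge $vw$ let $\lambda(vw)$ be the open line segment in $\mathbb{R}^d$ with endpoints $\lambda(v),\lambda(w)$. Two distinct edges cross if their open segments intersect. $\lambda$ is a $d$-dimensional hypercube drawing of $G$ if no two distinct edges cross; its volume is $2^d$. $\operatorname{vol}(G)$ is the minimum volume of a hypercube drawing of $G$ (over all integers $d\ge0$; this dimension is unrelated to the degeneracy in the claim). *)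

theory Defs
  imports Complex_Main "Jordan_Normal_Form.Matrix"
begin

text \<open>A graph is given by its vertex set \<open>V\<close> and its set \<open>E\<close> of two-element edges.\<close>

definition simple_graph :: "'a set \<Rightarrow> 'a set set \<Rightarrow> bool" where
  "simple_graph V E \<longleftrightarrow> finite V \<and> (\<forall>e\<in>E. e \<subseteq> V \<and> card e = 2)"

definition vertex_degree :: "'a set set \<Rightarrow> 'a \<Rightarrow> nat" where
  "vertex_degree E v = card {e \<in> E. v \<in> e}"

definition min_degree :: "'a set \<Rightarrow> 'a set set \<Rightarrow> nat" where
  "min_degree V E = Min (vertex_degree E ` V)"

definition induced_edges :: "'a set set \<Rightarrow> 'a set \<Rightarrow> 'a set set" where
  "induced_edges E S = {e \<in> E. e \<subseteq> S}"

definition degeneracy :: "'a set \<Rightarrow> 'a set set \<Rightarrow> nat" where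
  "degeneracy V E = Max {min_degree S (induced_edges E S) | S. S \<subseteq> V \<and> S \<noteq> {}}"

definition antimagic :: "'a set \<Rightarrow> 'a set set \<Rightarrow> ('a \<Rightarrow> nat) \<Rightarrow> bool" where
  "antimagic V E f \<longleftrightarrow>
     inj_on f V \<and> (\<forall>v\<in>V. f v > 0) \<and>
     (\<forall>v w x y. {v, w} \<in> E \<and> {x, y} \<in> E \<and> {v, w} \<noteq> {x, y} \<longrightarrow> f v + f w \<noteq> f x + f y)"

definition mag :: "'a set \<Rightarrow> 'a set set \<Rightarrow> nat" where
  "mag V E = (LEAST k. \<exists>f. antimagic V E f \<and> f ` V \<subseteq> {1..k})"

text \<open>The dimension has to vary inside the definition of \<open>vol\<close>, so points of \<open>d\<close>-dimensional
  real space are the elements of \<open>carrier_vec d\<close>; \<open>open_segment\<close> from HOL-Analysis does not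
  apply to this type.\<close>

definition hypercube :: "nat \<Rightarrow> real vec set" where
  "hypercube d = {p \<in> carrier_vec d. \<forall>i<d. p $ i \<in> {0, 1}}"

definition open_line_segment :: "real vec \<Rightarrow> real vec \<Rightarrow> real vec set" where
  "open_line_segment p q = {(1 - t) \<cdot>\<^sub>v p + t \<cdot>\<^sub>v q | t. 0 < t \<and> t < 1}"

definition hypercube_drawing ::
    "nat \<Rightarrow> 'a set \<Rightarrow> 'a set set \<Rightarrow> ('a \<Rightarrow> real vec) \<Rightarrow> bool" where
  "hypercube_drawing d V E l \<longleftrightarrow>
     inj_on l V \<and> l ` V \<subseteq> hypercube d \<and>
     (\<forall>v w x y. {v, w} \<in> E \<and> {x, y} \<in> E \<and> {v, w} \<noteq> {x, y} \<longrightarrow>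
        open_line_segment (l v) (l w) \<inter> open_line_segment (l x) (l y) = {})"

definition vol :: "'a set \<Rightarrow> 'a set set \<Rightarrow> nat" where
  "vol V E = (LEAST N. \<exists>d l. hypercube_drawing d V E l \<and> N = 2 ^ d)"

end

theory Submission
  imports Defs
begin

text \<open>
  Every nonempty set of vertices contains a vertex with at most \<open>d\<close> neighbours in the set, so
  the vertices can be labelled greedily, each having at most \<open>d\<close> neighbours labelled before it.
  A label \<open>c\<close> for \<open>v\<close> is ruled out only if it is already used (at most \<open>n - 1\<close> values) or if
  \<open>c + f u = f x + f y\<close> for a labelled neighbour \<open>u\<close> of \<open>v\<close> and an edge \<open>xy\<close> (at most \<open>d m\<close>
  values), so some label in \<open>{1..n + d m}\<close> is free.

  Given labels in \<open>{1..2 ^ D}\<close>, place \<open>v\<close> at the binary expansion of \<open>f v - 1\<close>. A point of an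
  open segment between two hypercube vertices determines the sum of its end points: in every
  coordinate the sum is 0, 1 or 2 according to whether the point has coordinate 0, strictly
  between 0 and 1, or 1. Hence crossing edges have equal label sums.
\<close>

section \<open>Greedy antimagic labelling\<close>

text \<open>The two ends of an edge are distinct, so \<open>sum f {v, w}\<close> has two summands.
  Edges can then be handled as sets, without naming their ends.\<close>

lemma antimagic_iff_inj_on_sum:
  assumes "simple_graph V E"
  shows "antimagic V E f \<longleftrightarrow> inj_on f V \<and> (\<forall>v\<in>V. f v > 0) \<and> inj_on (sum f) E"
proof -
  have sum_edge: "sum f {v, w} = f v + f w" if "{v, w} \<in> E" for v w
  proof -
    have "v \<noteq> w" using assms that by (auto simp: simple_graph_def)
    then show ?thesis by simp
  qed
  have "(\<forall>v w x y. {v, w} \<in> E \<and> {x, y} \<in> E \<and> {v, w} \<noteq> {x, y} \<longrightarrow> f v + f w \<noteq> f x + f y)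
          \<longleftrightarrow> inj_on (sum f) E" (is "?L \<longleftrightarrow> ?R")
  proof
    assume L: ?L
    show ?R
    proof (rule inj_onI)
      fix e e' assume e: "e \<in> E" "e' \<in> E" "sum f e = sum f e'"
      obtain v w x y where vw: "e = {v, w}" "e' = {x, y}"
        using assms e by (metis card_2_iff simple_graph_def)
      then show "e = e'" using L e sum_edge by metis
    qed
  next
    assume ?R
    then show ?L using sum_edge by (metis inj_on_def)
  qed
  then show ?thesis by (simp add: antimagic_def)
qed

lemma simple_graph_finite_edges: "simple_graph V E \<Longrightarrow> finite E"
  by (rule finite_subset[of _ "Pow V"]) (auto simp: simple_graph_def)

lemma simple_graph_induced:
  "simple_graph V E \<Longrightarrow> S \<subseteq> V \<Longrightarrow> simple_graph S (induced_edges E S)"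
  by (auto simp: simple_graph_def induced_edges_def intro: finite_subset)

text \<open>The minimum degree of the subgraph induced by \<open>S\<close> is attained, and
  \<open>degeneracy\<close> is a maximum over such minima. The vertex found here is the one of
  \<open>S\<close> to be labelled last.\<close>

lemma ex_vertex_degree_le_degeneracy:
  assumes "finite V" and "S \<subseteq> V" and "S \<noteq> {}"
  shows "\<exists>v\<in>S. vertex_degree (induced_edges E S) v \<le> degeneracy V E"
proof -
  let ?deg = "vertex_degree (induced_edges E S)"
  have "finite S" using assms finite_subset by blast
  then have "min_degree S (induced_edges E S) \<in> ?deg ` S"
    unfolding min_degree_def using assms by (intro Min_in) auto
  moreover have "min_degree S (induced_edges E S) \<le> degeneracy V E"
    unfolding degeneracy_def using assms by (intro Max_ge) auto
  ultimately show ?thesis by auto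
qed

text \<open>Old labels are kept, so sums of edges avoiding \<open>v\<close> stay distinct. Two edges
  at \<open>v\<close> have sums differing only in the labels of their other ends. Only an edge at
  \<open>v\<close> and an edge avoiding \<open>v\<close> can clash.\<close>

lemma antimagic_extend:
  fixes k :: nat
  assumes G: "simple_graph S E" and "v \<in> S"
    and f: "antimagic (S - {v}) (induced_edges E (S - {v})) f"
    and range: "f ` (S - {v}) \<subseteq> {1..k}"
    and k: "card (S - {v}) + vertex_degree E v * card E < k"
  shows "\<exists>g. antimagic S E g \<and> g ` S \<subseteq> {1..k}"
proof -
  let ?T = "S - {v}"
  let ?N = "{e \<in> E. v \<in> e}"
  \<comment> \<open>Here \<open>e' - {v}\<close> is the other end of \<open>e'\<close>. Truncated
    subtraction, and edges \<open>e\<close> at \<open>v\<close> with the arbitrary value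
    \<open>f v\<close>, merely add harmless values: only the size of \<open>B\<close> has to be
    bounded.\<close>
  define B where "B = f ` ?T \<union> (\<lambda>(e', e). sum f e - sum f (e' - {v})) ` (?N \<times> E)"
  have fin: "finite S" "finite E" "finite ?N"
    using G simple_graph_finite_edges[OF G] by (auto simp: simple_graph_def)
  have "finite B" using fin by (simp add: B_def)
  have "card B \<le> card ?T + card (?N \<times> E)"
    unfolding B_def using fin
    by (intro order.trans[OF card_Un_le] add_mono card_image_le) auto
  also have "\<dots> < card {1..k}"
    using k by (simp add: card_cartesian_product vertex_degree_def)
  finally have "\<not> {1..k} \<subseteq> B" using card_mono[OF \<open>finite B\<close>, of "{1..k}"] by linarith
  then obtain c where c: "c \<in> {1..k}" "c \<notin> B" by blast
  define g where "g = f(v := c)"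
  have IH: "inj_on f ?T" "\<forall>u\<in>?T. f u > 0" "inj_on (sum f) (induced_edges E ?T)"
    using f antimagic_iff_inj_on_sum[OF simple_graph_induced[OF G, of ?T]] by auto
  have fin_e: "finite e" if "e \<in> E" for e
    using that G by (auto simp: simple_graph_def intro: card_ge_0_finite)
  have sum_notin: "sum g e = sum f e" if "v \<notin> e" for e
    using that by (intro sum.cong) (auto simp: g_def)
  have sum_in: "sum g e = c + sum f (e - {v})" if "e \<in> E" "v \<in> e" for e
    using that fin_e sum_notin[of "e - {v}"] by (simp add: sum.remove[of e v] g_def)
  have other_end: "\<exists>u\<in>?T. e = {u, v}" if e: "e \<in> E" "v \<in> e" for e
  proof -
    have "card e = 2" "e \<subseteq> S" using G e by (auto simp: simple_graph_def)
    then show ?thesis using e(2) by (auto simp: card_2_iff)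
  qed
  have mixed: "sum g e' \<noteq> sum g e" if "e \<in> E" "v \<notin> e" "e' \<in> E" "v \<in> e'" for e e'
  proof
    assume "sum g e' = sum g e"
    then have "c = sum f e - sum f (e' - {v})" using that sum_in sum_notin by simp
    then have "c \<in> B" using that by (force simp: B_def)
    then show False using c by blast
  qed
  have "inj_on (sum g) E"
  proof (rule inj_onI)
    fix e e' assume e: "e \<in> E" "e' \<in> E" "sum g e = sum g e'"
    consider "v \<notin> e" "v \<notin> e'" | "v \<in> e" "v \<in> e'"
      using mixed e by metis
    then show "e = e'"
    proof cases
      case 1
      moreover from 1 have "e \<in> induced_edges E ?T" "e' \<in> induced_edges E ?T"
        using e G by (auto simp: induced_edges_def simple_graph_def)
      ultimately show ?thesis using IH(3) e sum_notin by (simp add: inj_on_def)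
    next
      case 2
      obtain u u' where u: "u \<in> ?T" "e = {u, v}" "u' \<in> ?T" "e' = {u', v}"
        using other_end e 2 by metis
      then have "e - {v} = {u}" "e' - {v} = {u'}" by auto
      then have "f u = f u'" using sum_in[of e] sum_in[of e'] e 2 by simp
      then show ?thesis using IH(1) u by (auto dest: inj_onD)
    qed
  qed
  moreover have "inj_on g S"
    using IH(1) c(2) by (force simp: g_def B_def inj_on_def)
  moreover have "g ` S \<subseteq> {1..k}"
    using range c by (auto simp: g_def)
  ultimately show ?thesis
    using antimagic_iff_inj_on_sum[OF G, of g] by fastforce
qed

text \<open>The bound refers to all of \<open>V\<close> and \<open>E\<close>, so the range of labels
  stays fixed while \<open>S\<close> grows by induction.\<close>

lemma ex_antimagic:
  assumes G: "simple_graph V E" and "S \<subseteq> V"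
  shows "\<exists>f. antimagic S (induced_edges E S) f
           \<and> f ` S \<subseteq> {1..card V + degeneracy V E * card E}"
  using \<open>S \<subseteq> V\<close>
proof (induction "card S" arbitrary: S)
  case 0
  have "finite S" using G 0(2) by (auto simp: simple_graph_def intro: finite_subset)
  then have S: "S = {}" using 0(1) by simp
  have "e \<notin> E" if "e \<subseteq> {}" for e
    using G that by (auto simp: simple_graph_def)
  then have "induced_edges E {} = {}" by (auto simp: induced_edges_def)
  then show ?case by (simp add: S antimagic_def)
next
  case (Suc j)
  let ?k = "card V + degeneracy V E * card E"
  let ?I = "induced_edges E"
  have "finite V" using G by (simp add: simple_graph_def)
  have "S \<noteq> {}" using Suc.hyps(2) by auto
  then obtain v where v: "v \<in> S" "vertex_degree (?I S) v \<le> degeneracy V E"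
    using ex_vertex_degree_le_degeneracy \<open>finite V\<close> Suc.prems by blast
  have "j = card (S - {v})" using v Suc.hyps(2) by simp
  with Suc obtain f where f:
    "antimagic (S - {v}) (?I (S - {v})) f" "f ` (S - {v}) \<subseteq> {1..?k}"
    by blast
  \<comment> \<open>The extension step takes place inside the subgraph induced by \<open>S\<close>,
    so that the degree of \<open>v\<close> counts only neighbours in \<open>S\<close>.\<close>
  have "?I (S - {v}) = induced_edges (?I S) (S - {v})"
    by (auto simp: induced_edges_def)
  with f(1) have f': "antimagic (S - {v}) (induced_edges (?I S) (S - {v})) f"
    by simp
  have "card (S - {v}) < card S" using \<open>j = card (S - {v})\<close> Suc.hyps(2) by simp
  also have "card S \<le> card V" using \<open>finite V\<close> Suc.prems by (rule card_mono)
  finally have "card (S - {v}) < card V" .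
  moreover have "card (?I S) \<le> card E"
    using simple_graph_finite_edges[OF G] by (intro card_mono) (auto simp: induced_edges_def)
  ultimately have "card (S - {v}) + vertex_degree (?I S) v * card (?I S) < ?k"
    using v by (intro add_less_le_mono mult_mono) auto
  then show ?case
    by (rule antimagic_extend[OF simple_graph_induced[OF G Suc.prems] v(1) f' f(2)])
qed

section \<open>From labels to hypercube drawings\<close>

lemma mag_le: "antimagic V E f \<Longrightarrow> f ` V \<subseteq> {1..k} \<Longrightarrow> mag V E \<le> k"
  unfolding mag_def by (rule Least_le) blast

lemma vol_le: "hypercube_drawing D V E l \<Longrightarrow> vol V E \<le> 2 ^ D"
  unfolding vol_def by (rule Least_le) blast

text \<open>The parameters \<open>t\<close> and \<open>u\<close> may differ; what matters is only
  whether the common value is 0, 1 or strictly between.\<close>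

lemma convex_combination_01_eq_imp_sum_eq:
  fixes p q r s t u :: real
  assumes "p \<in> {0, 1}" "q \<in> {0, 1}" "r \<in> {0, 1}" "s \<in> {0, 1}"
    and "0 < t" "t < 1" "0 < u" "u < 1"
    and "(1 - t) * p + t * q = (1 - u) * r + u * s"
  shows "p + q = r + s"
  using assms by auto

lemma hypercube_crossing_imp_sum_eq:
  assumes cube: "p \<in> hypercube D" "q \<in> hypercube D" "r \<in> hypercube D" "s \<in> hypercube D"
    and cross: "open_line_segment p q \<inter> open_line_segment r s \<noteq> {}"
    and "i < D"
  shows "p $ i + q $ i = r $ i + s $ i"
proof -
  from cross obtain t u where tu: "0 < t" "t < 1" "0 < u" "u < 1"
    and eq: "(1 - t) \<cdot>\<^sub>v p + t \<cdot>\<^sub>v q = (1 - u) \<cdot>\<^sub>v r + u \<cdot>\<^sub>v s"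
    by (auto simp: open_line_segment_def)
  have dims: "dim_vec p = D" "dim_vec q = D" "dim_vec r = D" "dim_vec s = D"
    using cube by (auto simp: hypercube_def)
  have "((1 - t) \<cdot>\<^sub>v p + t \<cdot>\<^sub>v q) $ i = ((1 - u) \<cdot>\<^sub>v r + u \<cdot>\<^sub>v s) $ i"
    using eq by simp
  then have eq_i: "(1 - t) * p $ i + t * q $ i = (1 - u) * r $ i + u * s $ i"
    using dims \<open>i < D\<close> by simp
  have "p $ i \<in> {0, 1}" "q $ i \<in> {0, 1}" "r $ i \<in> {0, 1}" "s $ i \<in> {0, 1}"
    using cube \<open>i < D\<close> by (auto simp: hypercube_def)
  then show ?thesis
    using tu eq_i by (rule convex_combination_01_eq_imp_sum_eq)
qed

definition bit_vec :: "nat \<Rightarrow> nat \<Rightarrow> real vec" where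
  "bit_vec D a = vec D (\<lambda>i. of_bool (bit a i))"

lemma bit_vec_in_hypercube: "bit_vec D a \<in> hypercube D"
  by (auto simp: bit_vec_def hypercube_def)

text \<open>The label depends linearly on the coordinates, so coordinatewise equal sums of end
  points give equal sums of labels.\<close>

lemma bit_vec_sum:
  assumes "a < 2 ^ D"
  shows "real a = (\<Sum>i<D. bit_vec D a $ i * 2 ^ i)"
proof -
  have "a = take_bit D a" using assms by (simp add: take_bit_nat_eq_self)
  also have "\<dots> = (\<Sum>i<D. of_bool (bit a i) * 2 ^ i)"
    by (simp add: take_bit_sum push_bit_eq_mult lessThan_atLeast0)
  finally have "real a = real (\<Sum>i<D. of_bool (bit a i) * 2 ^ i)" by simp
  also have "\<dots> = (\<Sum>i<D. bit_vec D a $ i * 2 ^ i)"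
    unfolding of_nat_sum by (intro sum.cong) (auto simp: bit_vec_def)
  finally show ?thesis .
qed

lemma hypercube_drawing_of_antimagic:
  assumes G: "simple_graph V E" and f: "antimagic V E f" and range: "f ` V \<subseteq> {1..2 ^ D}"
  shows "hypercube_drawing D V E (\<lambda>v. bit_vec D (f v - 1))"
proof -
  let ?l = "\<lambda>v. bit_vec D (f v - 1)"
  have sum_bits: "real (f v) = 1 + (\<Sum>i<D. ?l v $ i * 2 ^ i)" if "v \<in> V" for v
  proof -
    have "1 \<le> f v" "f v \<le> 2 ^ D" using range that by auto
    \<comment> \<open>Labels start at 1, so the shift lets the label \<open>2 ^ D\<close> itself fit
      into \<open>D\<close> bits.\<close>
    then have "f v - 1 < 2 ^ D" by linarith
    with \<open>1 \<le> f v\<close> show ?thesis using bit_vec_sum[of "f v - 1" D] by (simp add: of_nat_diff)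
  qed
  have "inj_on ?l V"
  proof (rule inj_onI)
    fix v w assume "v \<in> V" "w \<in> V" "?l v = ?l w"
    then have "real (f v) = real (f w)" using sum_bits by metis
    then show "v = w" using f \<open>v \<in> V\<close> \<open>w \<in> V\<close> by (auto simp: antimagic_def dest: inj_onD)
  qed
  moreover have "open_line_segment (?l v) (?l w) \<inter> open_line_segment (?l x) (?l y) = {}"
    if e: "{v, w} \<in> E" "{x, y} \<in> E" "{v, w} \<noteq> {x, y}" for v w x y
  proof (rule ccontr)
    assume cross:
      "open_line_segment (?l v) (?l w) \<inter> open_line_segment (?l x) (?l y) \<noteq> {}"
    have eq: "?l v $ i + ?l w $ i = ?l x $ i + ?l y $ i" if "i < D" for i
      by (rule hypercube_crossing_imp_sum_eq[OF _ _ _ _ cross that]) (rule bit_vec_in_hypercube)+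
    have V: "v \<in> V" "w \<in> V" "x \<in> V" "y \<in> V" using G e by (auto simp: simple_graph_def)
    have "real (f v) + real (f w) = 2 + (\<Sum>i<D. (?l v $ i + ?l w $ i) * 2 ^ i)"
      using V by (simp add: sum_bits sum.distrib distrib_right)
    also have "\<dots> = 2 + (\<Sum>i<D. (?l x $ i + ?l y $ i) * 2 ^ i)"
      using eq by simp
    also have "\<dots> = real (f x) + real (f y)"
      using V by (simp add: sum_bits sum.distrib distrib_right)
    finally have "f v + f w = f x + f y" by linarith
    then show False using f e by (auto simp: antimagic_def)
  qed
  ultimately show ?thesis
    using bit_vec_in_hypercube by (auto simp: hypercube_drawing_def)
qed

lemma ex_power2_between:
  fixes k :: nat
  assumes "k \<ge> 1"
  shows "\<exists>D. k \<le> 2 ^ D \<and> 2 ^ D < 2 * k"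
proof -
  \<comment> \<open>By minimality the preceding power of two, if any, is below \<open>k\<close>, and
    doubling it gives the upper bound.\<close>
  define D where "D = (LEAST j. k \<le> 2 ^ j)"
  have "k \<le> 2 ^ D" unfolding D_def by (rule LeastI[of _ k]) simp
  moreover have "2 ^ D < 2 * k"
  proof (cases D)
    case (Suc j)
    then have "\<not> k \<le> 2 ^ j" using not_less_Least[of j "\<lambda>j. k \<le> 2 ^ j"] by (simp add: D_def)
    then show ?thesis using Suc by simp
  qed (use assms in simp)
  ultimately show ?thesis by blast
qed

theorem lemma8:
  fixes V :: "'a set" and E :: "'a set set" and n m d :: nat
  assumes "simple_graph V E"
    and "card V = n" and "n \<ge> 1"
    and "card E = m"
    and "degeneracy V E = d"
  shows "mag V E \<le> n + d * m \<and> vol V E < 2 * n + 2 * d * m"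
proof -
  have "induced_edges E V = E"
    using assms by (auto simp: induced_edges_def simple_graph_def)
  then obtain f where f: "antimagic V E f" "f ` V \<subseteq> {1..n + d * m}"
    using ex_antimagic[OF assms(1), of V] assms by auto
  obtain D where D: "n + d * m \<le> 2 ^ D" "2 ^ D < 2 * (n + d * m)"
    using ex_power2_between[of "n + d * m"] assms by auto
  from D(1) have "{1..n + d * m} \<subseteq> {1..2 ^ D}" by auto
  then have "vol V E \<le> 2 ^ D"
    using vol_le hypercube_drawing_of_antimagic[OF assms(1) f(1)] f(2) by blast
  with D(2) mag_le[OF f] show ?thesis by (simp add: algebra_simps)
qed

end
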